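(* Let $d\ge2$, $u\in C^2(\mathbb R^d)$, and let $X$ be the gradient flow $\partial_tX(t,x)=\nabla u(X(t,x))$, $X(0,x)=x$. Let $x_*$ be an isolated critical point of $u$ with $\Delta u(x_* )=0$, and assume $x_*$ is positively (resp. negatively) stable: there exist a compact neighborhood $K_*$ of $x_*$ containing no other critical point of $u$, and a neighborhood $Q_*$ of $x_*$ with $Q_*\subset\mathrm{int}(K_* )$, such that $X(t,x)\in K_*$ for all $x\in Q_*$ and all $t\ge0$ (resp. all $t\le 0$). Assume there is a constant $C_*>0$ such that $$\Big|\int_0^t\Delta u\big(X(s,x)\big)\,ds\Big|\le C_*\quad\text{for all } x\in Q_* \text{ and all } t\ge0\ (\text{resp. } t\le0).$$ Then $u$ is constant in a neighborhood of $x_*$. *)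

theory Defs
  imports "HOL-Analysis.Analysis"
begin

definition pderiv_dir :: "('a::euclidean_space \<Rightarrow> real) \<Rightarrow> 'a \<Rightarrow> 'a \<Rightarrow> real" where
  "pderiv_dir u b x = frechet_derivative u (at x) b"

definition grad :: "('a::euclidean_space \<Rightarrow> real) \<Rightarrow> 'a \<Rightarrow> 'a" where
  "grad u x = (\<Sum>b\<in>Basis. pderiv_dir u b x *\<^sub>R b)"

definition laplacian :: "('a::euclidean_space \<Rightarrow> real) \<Rightarrow> 'a \<Rightarrow> real" where
  "laplacian u x = (\<Sum>b\<in>Basis. pderiv_dir (pderiv_dir u b) b x)"

definition C2 :: "('a::euclidean_space \<Rightarrow> real) \<Rightarrow> bool" where
  "C2 u \<longleftrightarrow> (\<forall>x. u differentiable (at x)) \<and>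
     (\<forall>b\<in>Basis. \<forall>x. pderiv_dir u b differentiable (at x)) \<and>
     (\<forall>b\<in>Basis. \<forall>c\<in>Basis. continuous_on UNIV (pderiv_dir (pderiv_dir u b) c))"

end

theory Submission
  imports Defs
begin

text \<open>
  The hypotheses are contradictory. Since \<open>u\<close> is a strict Lyapunov function and \<open>K\<close> contains only
  one critical point, the flow carries every point of \<open>Q\<close> to \<open>xs\<close>, so it eventually
  squeezes (most of) a ball around \<open>xs\<close> into an arbitrarily small one. By Liouville's
  formula, on the other hand, it shrinks volumes at most by the factor \<open>exp (- C)\<close>.

  Differentiability of the flow in the initial value and Jacobian determinants are avoided: the
  flow is approximated by iterating the splitting scheme \<open>x \<mapsto> x + h v\<^sub>b(x) b\<close>, \<open>b\<close> running through
  the basis. Each such shear moves one coordinate only, so Fubini and the one-dimensional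
  substitution rule give its volume distortion \<open>1 + h \<partial>\<^sub>b v\<^sub>b\<close>, and the product of these factors along
  an orbit approximates the exponential of the integrated divergence. Points and distortion factors
  converge uniformly, which is all the contradiction needs.
\<close>

subsection \<open>Volume distortion of shears\<close>

text \<open>Fubini: Lebesgue measure is the image of a product measure over \<open>Basis\<close>,
  from which the factor \<open>b\<close> is split off. The outer variable \<open>z\<close>
  enumerates the lines parallel to \<open>b\<close>.\<close>

lemma nn_integral_lborel_coordinate:
  fixes f :: "'a::euclidean_space \<Rightarrow> ennreal"
  assumes [measurable]: "f \<in> borel_measurable borel" and b: "b \<in> Basis"
  shows "(\<integral>\<^sup>+x. f x \<partial>lborel) =
    (\<integral>\<^sup>+z. (\<integral>\<^sup>+y. f ((\<Sum>c\<in>Basis - {b}. z c *\<^sub>R c) + y *\<^sub>R b) \<partial>lborel) \<partial>(\<Pi>\<^sub>M c\<in>Basis - {b}. lborel))"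
proof -
  interpret product_sigma_finite "\<lambda>_::'a. lborel :: real measure"
    by standard
  have ins: "insert b (Basis - {b}) = (Basis :: 'a set)"
    using b by auto
  let ?g = "\<lambda>x::'a \<Rightarrow> real. f (\<Sum>c\<in>Basis. x c *\<^sub>R c)"
  have "(\<integral>\<^sup>+x. f x \<partial>lborel) = (\<integral>\<^sup>+x. ?g x \<partial>(\<Pi>\<^sub>M c\<in>Basis. lborel))"
    by (subst lborel_eq) (subst nn_integral_distr, auto)
  also have "\<dots> = (\<integral>\<^sup>+x. ?g x \<partial>(\<Pi>\<^sub>M c\<in>insert b (Basis - {b}). lborel))"
    by (simp only: ins)
  also have "\<dots> = (\<integral>\<^sup>+z. (\<integral>\<^sup>+y. ?g (z(b := y)) \<partial>lborel) \<partial>(\<Pi>\<^sub>M c\<in>Basis - {b}. lborel))"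
    by (rule product_nn_integral_insert) (simp_all only: ins, auto)
  also have "\<dots> = (\<integral>\<^sup>+z. (\<integral>\<^sup>+y. f ((\<Sum>c\<in>Basis - {b}. z c *\<^sub>R c) + y *\<^sub>R b) \<partial>lborel) \<partial>(\<Pi>\<^sub>M c\<in>Basis - {b}. lborel))"
  proof (intro nn_integral_cong arg_cong[where f=f])
    fix z y
    have "(\<Sum>c\<in>Basis. (z(b := y)) c *\<^sub>R c) = (\<Sum>c\<in>insert b (Basis - {b}). (z(b := y)) c *\<^sub>R c)"
      by (simp only: ins)
    also have "\<dots> = (\<Sum>c\<in>Basis - {b}. z c *\<^sub>R c) + y *\<^sub>R b"
      by (subst sum.insert) (auto simp: add.commute intro!: sum.cong)
    finally show "(\<Sum>c\<in>Basis. (z(b := y)) c *\<^sub>R c) = (\<Sum>c\<in>Basis - {b}. z c *\<^sub>R c) + y *\<^sub>R b" .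
  qed
  finally show ?thesis .
qed

text \<open>The substitution rule needs an interval, while \<open>S\<close> is any compact set. With
  the indicator of \<open>g\<close>
  S\<open>built into the integrand, enlarging\<close>S\<open>to\<close>{a..b}\<open>can only
  increase the left side, and there the rule is exact.
  As\<close>g\<open>may be constant on pieces and other points may map into\<close>g
  \<open>S\<close>, only an inequality results.\<close>

lemma nn_integral_substitution_le:
  fixes f :: "real \<Rightarrow> ennreal" and g g' :: "real \<Rightarrow> real"
  assumes [measurable]: "f \<in> borel_measurable borel"
    and S: "compact S" "S \<subseteq> {a..b}" and ab: "a < b"
    and g: "\<And>x. x \<in> {a..b} \<Longrightarrow> (g has_real_derivative g' x) (at x)"
    and g': "continuous_on {a..b} g'" "\<And>x. x \<in> {a..b} \<Longrightarrow> g' x \<ge> 0"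
  shows "(\<integral>\<^sup>+x. f (g x) * g' x * indicator S x \<partial>lborel) \<le> (\<integral>\<^sup>+y. f y * indicator (g ` S) y \<partial>lborel)"
proof -
  have "continuous_on S g"
    using S(2) by (intro continuous_at_imp_continuous_on ballI) (blast intro: DERIV_isCont g)
  then have "compact (g ` S)"
    using S(1) by (rule compact_continuous_image)
  then have [measurable]: "g ` S \<in> sets borel"
    by (simp add: borel_compact)
  have "(\<integral>\<^sup>+x. f (g x) * g' x * indicator S x \<partial>lborel)
      \<le> (\<integral>\<^sup>+x. (f (g x) * indicator (g ` S) (g x)) * g' x * indicator {a..b} x \<partial>lborel)"
    using S(2) by (intro nn_integral_mono) (auto split: split_indicator)
  also have "\<dots> = (\<integral>\<^sup>+y. (f y * indicator (g ` S) y) * indicator {g a..g b} y \<partial>lborel)"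
    by (rule nn_integral_substitution_aux[symmetric, OF _ _ g g' ab]) auto
  also have "\<dots> \<le> (\<integral>\<^sup>+y. f y * indicator (g ` S) y \<partial>lborel)"
    by (intro nn_integral_mono) (auto split: split_indicator)
  finally show ?thesis .
qed

text \<open>On a line parallel to \<open>b\<close> the shear is a function of one variable with
  derivative \<open>1 + g'\<close>. One-dimensional substitution on each line, followed by
  integration over all lines, gives the bound.\<close>

lemma nn_integral_shear_le:
  fixes f :: "'a::euclidean_space \<Rightarrow> ennreal" and g g' :: "'a \<Rightarrow> real"
  assumes f[measurable]: "f \<in> borel_measurable borel" and b: "b \<in> Basis"
    and S: "compact S" "S \<subseteq> cbox (- R *\<^sub>R One) (R *\<^sub>R One)" and R: "R > 0"
    and g: "\<And>x t. ((\<lambda>t. g (x + t *\<^sub>R b)) has_real_derivative g' (x + t *\<^sub>R b)) (at t)"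
    and gc: "continuous_on UNIV g" and g'c: "continuous_on UNIV g'"
    and pos: "\<And>x. x \<in> cbox (- R *\<^sub>R One) (R *\<^sub>R One) \<Longrightarrow> 1 + g' x \<ge> 0"
  shows "(\<integral>\<^sup>+x. f (x + g x *\<^sub>R b) * ennreal (1 + g' x) * indicator S x \<partial>lborel)
     \<le> (\<integral>\<^sup>+y. f y * indicator ((\<lambda>x. x + g x *\<^sub>R b) ` S) y \<partial>lborel)"
proof -
  let ?G = "\<lambda>x. x + g x *\<^sub>R b"
  have [measurable]: "g \<in> borel_measurable borel" "g' \<in> borel_measurable borel"
    using gc g'c by (auto intro: borel_measurable_continuous_onI)
  have Gc: "continuous_on S ?G"
    by (intro continuous_intros continuous_on_subset[OF gc]) auto
  then have "compact (?G ` S)"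
    using S(1) by (rule compact_continuous_image)
  then have [measurable]: "S \<in> sets borel" "?G ` S \<in> sets borel"
    using S(1) by (auto simp: borel_compact)
  define P :: "('a \<Rightarrow> real) \<Rightarrow> 'a" where "P z = (\<Sum>c\<in>Basis - {b}. z c *\<^sub>R c)" for z
  have Pc: "P z \<bullet> c = (if c = b then 0 else z c)" if "c \<in> Basis" for z c
    using that unfolding P_def
    by (auto simp: inner_sum_left inner_Basis sum.delta if_distrib cong: if_cong)
  have line: "(\<integral>\<^sup>+y. f (?G (P z + y *\<^sub>R b)) * ennreal (1 + g' (P z + y *\<^sub>R b)) * indicator S (P z + y *\<^sub>R b) \<partial>lborel)
     \<le> (\<integral>\<^sup>+y. f (P z + y *\<^sub>R b) * indicator (?G ` S) (P z + y *\<^sub>R b) \<partial>lborel)" for z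
  proof -
    define T where "T = (\<lambda>y. P z + y *\<^sub>R b) -` S"
    define \<gamma> where "\<gamma> y = y + g (P z + y *\<^sub>R b)" for y
    have G: "?G (P z + y *\<^sub>R b) = P z + \<gamma> y *\<^sub>R b" for y
      by (simp add: \<gamma>_def algebra_simps)
    have TR: "T \<subseteq> {-R..R}"
    proof
      fix y assume "y \<in> T"
      then have "P z + y *\<^sub>R b \<in> cbox (- R *\<^sub>R One) (R *\<^sub>R One)"
        using S(2) by (auto simp: T_def)
      then show "y \<in> {-R..R}"
        using b Pc[OF b] by (auto simp: mem_box inner_add_left dest!: bspec[OF _ b])
    qed
    have "closed T"
      unfolding T_def using compact_imp_closed[OF S(1)]
      by (intro closed_vimage continuous_intros)
    then have T: "compact T"
      using TR by (metis compact_Icc compact_Int_closed inf.absorb2)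
    show ?thesis
    proof (cases "T = {}")
      case True
      then have "indicator S (P z + y *\<^sub>R b) = (0::ennreal)" for y
        by (simp add: T_def indicator_def vimage_def)
      then show ?thesis by simp
    next
      case False
      then obtain y0 where "y0 \<in> T" by auto
      then have "P z + y0 *\<^sub>R b \<in> cbox (- R *\<^sub>R One) (R *\<^sub>R One)"
        using S(2) by (auto simp: T_def)
      then have zR: "\<bar>z c\<bar> \<le> R" if "c \<in> Basis" "c \<noteq> b" for c
        using that b Pc[of c z] by (force simp: mem_box inner_add_left inner_Basis abs_le_iff)
      \<comment> \<open>The slices of \<open>S\<close> need not be intervals, but the box is convex:
        once the line meets it, all of \<open>{-R..R}\<close> on that line lies in it, so \<gamma>
        has nonnegative derivative on a full interval, as substitution requires.\<close>
      have inbox: "P z + y *\<^sub>R b \<in> cbox (- R *\<^sub>R One) (R *\<^sub>R One)" if "y \<in> {-R..R}" for y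
        unfolding mem_box
      proof
        fix c :: 'a assume c: "c \<in> Basis"
        show "- R *\<^sub>R One \<bullet> c \<le> (P z + y *\<^sub>R b) \<bullet> c \<and> (P z + y *\<^sub>R b) \<bullet> c \<le> R *\<^sub>R One \<bullet> c"
          using that b c zR[of c] Pc[OF c, of z]
          by (cases "c = b") (auto simp: inner_add_left inner_Basis abs_le_iff)
      qed
      have [measurable]: "(\<lambda>y. f (P z + y *\<^sub>R b)) \<in> borel_measurable borel"
        by measurable
      have "(\<integral>\<^sup>+y. f (?G (P z + y *\<^sub>R b)) * ennreal (1 + g' (P z + y *\<^sub>R b)) * indicator S (P z + y *\<^sub>R b) \<partial>lborel)
         = (\<integral>\<^sup>+y. f (P z + \<gamma> y *\<^sub>R b) * ennreal (1 + g' (P z + y *\<^sub>R b)) * indicator T y \<partial>lborel)"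
        unfolding G by (intro nn_integral_cong) (auto simp: T_def split: split_indicator)
      also have "\<dots> \<le> (\<integral>\<^sup>+y. f (P z + y *\<^sub>R b) * indicator (\<gamma> ` T) y \<partial>lborel)"
      proof (rule nn_integral_substitution_le[OF _ T TR])
        show "continuous_on {-R..R} (\<lambda>y. 1 + g' (P z + y *\<^sub>R b))"
          by (intro continuous_intros continuous_on_compose2[OF g'c]) auto
        show "(\<gamma> has_real_derivative 1 + g' (P z + y *\<^sub>R b)) (at y)" for y
          unfolding \<gamma>_def by (intro DERIV_add DERIV_ident g)
        show "1 + g' (P z + y *\<^sub>R b) \<ge> 0" if "y \<in> {-R..R}" for y
          by (intro pos inbox that)
      qed (use R in auto)
      also have "\<dots> \<le> (\<integral>\<^sup>+y. f (P z + y *\<^sub>R b) * indicator (?G ` S) (P z + y *\<^sub>R b) \<partial>lborel)"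
      proof (intro nn_integral_mono mult_left_mono)
        fix y
        have "P z + y *\<^sub>R b \<in> ?G ` S" if y: "y \<in> \<gamma> ` T"
        proof -
          obtain t where "t \<in> T" "y = \<gamma> t"
            using y by auto
          then show ?thesis
            using G[of t] by (intro image_eqI[of _ _ "P z + t *\<^sub>R b"]) (auto simp: T_def)
        qed
        then show "indicator (\<gamma> ` T) y \<le> (indicator (?G ` S) (P z + y *\<^sub>R b) :: ennreal)"
          by (auto split: split_indicator)
      qed auto
      finally show ?thesis .
    qed
  qed
  have "(\<integral>\<^sup>+x. f (?G x) * ennreal (1 + g' x) * indicator S x \<partial>lborel)
    = (\<integral>\<^sup>+z. (\<integral>\<^sup>+y. f (?G (P z + y *\<^sub>R b)) * ennreal (1 + g' (P z + y *\<^sub>R b)) * indicator S (P z + y *\<^sub>R b) \<partial>lborel)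
        \<partial>(\<Pi>\<^sub>M c\<in>Basis - {b}. lborel))"
    unfolding P_def by (rule nn_integral_lborel_coordinate[OF _ b]) measurable
  also have "\<dots> \<le> (\<integral>\<^sup>+z. (\<integral>\<^sup>+y. f (P z + y *\<^sub>R b) * indicator (?G ` S) (P z + y *\<^sub>R b) \<partial>lborel)
        \<partial>(\<Pi>\<^sub>M c\<in>Basis - {b}. lborel))"
    by (intro nn_integral_mono line)
  also have "\<dots> = (\<integral>\<^sup>+y. f y * indicator (?G ` S) y \<partial>lborel)"
    unfolding P_def by (rule nn_integral_lborel_coordinate[OF _ b, symmetric]) measurable
  finally show ?thesis .
qed

subsection \<open>The splitting scheme\<close>

lemma norm_increment_le:
  fixes Y :: "real \<Rightarrow> 'a::real_normed_vector"
  assumes "a \<le> b" "\<And>s. s \<in> {a..b} \<Longrightarrow> (Y has_vector_derivative Y' s) (at s within {a..b})"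
    and "\<And>s. s \<in> {a..b} \<Longrightarrow> norm (Y' s) \<le> B"
  shows "norm (Y b - Y a) \<le> B * (b - a)"
proof -
  have "norm (Y b - Y a) \<le> B * norm (b - a)"
  proof (rule differentiable_bound[where S = "{a..b}" and f' = "\<lambda>s h. h *\<^sub>R Y' s"])
    show "onorm (\<lambda>h. h *\<^sub>R Y' s) \<le> B" if "s \<in> {a..b}" for s
      using assms(3)[OF that] by (intro onorm_bound) (auto simp: mult.commute[of B] mult_left_mono intro: order_trans[OF norm_ge_zero])
  qed (use assms in \<open>auto simp: has_vector_derivative_def\<close>)
  with \<open>a \<le> b\<close> show ?thesis by simp
qed

text \<open>\<open>v b\<close> is the component of a vector field along \<open>b\<close> and
  \<open>q b\<close> its derivative in that same direction, so that the sum of the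
  \<open>q b\<close> is the divergence. The off-diagonal partial derivatives enter only through the
  local Lipschitz bound.\<close>

locale c1_field =
  fixes v q :: "'a::euclidean_space \<Rightarrow> 'a \<Rightarrow> real"
  assumes v_cont: "b \<in> Basis \<Longrightarrow> continuous_on UNIV (v b)"
    and q_cont: "b \<in> Basis \<Longrightarrow> continuous_on UNIV (q b)"
    and v_deriv: "b \<in> Basis \<Longrightarrow> ((\<lambda>t. v b (x + t *\<^sub>R b)) has_real_derivative q b (x + t *\<^sub>R b)) (at t)"
    and v_lipschitz: "compact S \<Longrightarrow> convex S \<Longrightarrow>
      \<exists>L\<ge>0. \<forall>x\<in>S. \<forall>y\<in>S. norm ((\<Sum>b\<in>Basis. v b x *\<^sub>R b) - (\<Sum>b\<in>Basis. v b y *\<^sub>R b)) \<le> L * norm (x - y)"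
begin

definition field :: "'a \<Rightarrow> 'a" where
  "field x = (\<Sum>b\<in>Basis. v b x *\<^sub>R b)"

definition dvg :: "'a \<Rightarrow> real" where
  "dvg x = (\<Sum>b\<in>Basis. q b x)"

text \<open>
  A list of directions encodes a composition of shears, so \<open>n\<close> time steps are \<open>n\<close> concatenated copies
  of the basis. The Jacobian determinant of \<open>pt\<close> is \<open>wt\<close>; its factors are only nonnegative on a bounded
  region, so the orbits have to be kept \<open>inside\<close> it.
\<close>

primrec pt :: "real \<Rightarrow> 'a list \<Rightarrow> 'a \<Rightarrow> 'a" where
  "pt h [] x = x"
| "pt h (b # bs) x = pt h bs (x + (h * v b x) *\<^sub>R b)"

primrec wt :: "real \<Rightarrow> 'a list \<Rightarrow> 'a \<Rightarrow> real" where
  "wt h [] x = 1"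
| "wt h (b # bs) x = (1 + h * q b x) * wt h bs (x + (h * v b x) *\<^sub>R b)"

primrec inside :: "'a set \<Rightarrow> real \<Rightarrow> 'a list \<Rightarrow> 'a \<Rightarrow> bool" where
  "inside D h [] x \<longleftrightarrow> True"
| "inside D h (b # bs) x \<longleftrightarrow> x \<in> D \<and> inside D h bs (x + (h * v b x) *\<^sub>R b)"

lemma pt_append: "pt h (bs @ cs) x = pt h cs (pt h bs x)"
  by (induction bs arbitrary: x) auto

lemma wt_append: "wt h (bs @ cs) x = wt h bs x * wt h cs (pt h bs x)"
  by (induction bs arbitrary: x) auto

lemma inside_append: "inside D h (bs @ cs) x \<longleftrightarrow> inside D h bs x \<and> inside D h cs (pt h bs x)"
  by (induction bs arbitrary: x) auto

lemma continuous_on_substep: "b \<in> Basis \<Longrightarrow> continuous_on UNIV (\<lambda>x. x + (h * v b x) *\<^sub>R b)"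
  by (intro continuous_intros v_cont)

lemma continuous_on_pt: "set bs \<subseteq> Basis \<Longrightarrow> continuous_on UNIV (pt h bs)"
proof (induction bs)
  case (Cons b bs)
  then show ?case
    by (auto intro: continuous_on_compose2[OF _ continuous_on_substep])
qed simp

lemma continuous_on_wt: "set bs \<subseteq> Basis \<Longrightarrow> continuous_on UNIV (wt h bs)"
proof (induction bs)
  case (Cons b bs)
  then show ?case
    by (auto intro!: continuous_intros q_cont intro: continuous_on_compose2[OF _ continuous_on_substep])
qed simp

text \<open>Peel off the first shear with \<open>nn_integral_shear_le\<close>, taking as test
  function the integrand for the remaining list. Its image of \<open>S\<close> is again compact and
  stays \<open>inside\<close> for the rest, which is why the induction generalises over
  \<open>S\<close>.\<close>

lemma nn_integral_pt_le:
  assumes f: "f \<in> borel_measurable borel" and R: "R > 0"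
    and pos: "\<And>b x. b \<in> Basis \<Longrightarrow> x \<in> cbox (- R *\<^sub>R One) (R *\<^sub>R One) \<Longrightarrow> 1 + h * q b x \<ge> 0"
    and "set bs \<subseteq> Basis" "compact S" "\<And>x. x \<in> S \<Longrightarrow> inside (cbox (- R *\<^sub>R One) (R *\<^sub>R One)) h bs x"
  shows "(\<integral>\<^sup>+x. f (pt h bs x) * ennreal (wt h bs x) * indicator S x \<partial>lborel) \<le> (\<integral>\<^sup>+y. f y \<partial>lborel)"
  using assms(4-)
proof (induction bs arbitrary: S)
  case Nil
  show ?case
    by (intro nn_integral_mono) (auto split: split_indicator)
next
  case (Cons b bs)
  let ?D = "cbox (- R *\<^sub>R One) (R *\<^sub>R One) :: 'a set"
  let ?G = "\<lambda>x. x + (h * v b x) *\<^sub>R b"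
  let ?f = "\<lambda>y. f (pt h bs y) * ennreal (wt h bs y)"
  have b: "b \<in> Basis" and bs: "set bs \<subseteq> Basis"
    using Cons.prems by auto
  have SD: "S \<subseteq> ?D"
    using Cons.prems by auto
  have [measurable]: "pt h bs \<in> borel_measurable borel" "wt h bs \<in> borel_measurable borel"
    using continuous_on_pt[OF bs] continuous_on_wt[OF bs] by (auto intro: borel_measurable_continuous_onI)
  note f[measurable]
  have "(\<integral>\<^sup>+x. f (pt h (b # bs) x) * ennreal (wt h (b # bs) x) * indicator S x \<partial>lborel)
      = (\<integral>\<^sup>+x. ?f (?G x) * ennreal (1 + h * q b x) * indicator S x \<partial>lborel)"
    using SD by (intro nn_integral_cong)
      (auto simp: ennreal_mult'[OF pos[OF b]] mult_ac split: split_indicator)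
  also have "\<dots> \<le> (\<integral>\<^sup>+y. ?f y * indicator (?G ` S) y \<partial>lborel)"
  proof (rule nn_integral_shear_le[OF _ b Cons.prems(2) SD R])
    show "((\<lambda>t. h * v b (x + t *\<^sub>R b)) has_real_derivative h * q b (x + t *\<^sub>R b)) (at t)" for x t
      by (intro DERIV_cmult v_deriv b)
  qed (use pos[OF b] b in \<open>auto intro!: continuous_intros v_cont q_cont\<close>)
  also have "\<dots> \<le> (\<integral>\<^sup>+y. f y \<partial>lborel)"
    using Cons.prems
    by (intro Cons.IH bs compact_continuous_image continuous_on_subset[OF continuous_on_substep[OF b]]) auto
  finally show ?case .
qed

text \<open>Coefficients are frozen at \<open>z\<close> while the current point \<open>y\<close>
  moves; the hypothesis with \<open>length bs\<close> reserves enough of the radius \<rho> for the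
  shears still to come. Each shear errs by \<open>h * \<eta>\<close> in position. In the logarithm
  of the weight it loses \<open>h * \<eta>\<close> through the variation of \<open>q b\<close> and
  another \<open>h * \<eta>\<close> through the quadratic term of the logarithm, hence
  \<open>2 * \<eta>\<close>.\<close>

lemma sweep_estimate:
  fixes h M \<eta> \<rho> :: real
  assumes M: "M \<ge> 0" and h: "h > 0" "h * M \<le> 1/2" "2 * (h * M\<^sup>2) \<le> \<eta>"
    and near: "\<And>b y. b \<in> Basis \<Longrightarrow> dist y z \<le> \<rho> \<Longrightarrow>
        y \<in> D \<and> \<bar>v b y\<bar> \<le> M \<and> \<bar>q b y\<bar> \<le> M \<and> \<bar>v b y - v b z\<bar> \<le> \<eta> \<and> \<bar>q b y - q b z\<bar> \<le> \<eta>"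
    and "set bs \<subseteq> Basis" "dist y z + length bs * (h * M) \<le> \<rho>"
  shows "inside D h bs y \<and>
      norm (pt h bs y - y - h *\<^sub>R (\<Sum>b\<leftarrow>bs. v b z *\<^sub>R b)) \<le> length bs * (h * \<eta>) \<and>
      wt h bs y \<ge> exp (h * (\<Sum>b\<leftarrow>bs. q b z - 2 * \<eta>))"
  using assms(6-)
proof (induction bs arbitrary: y)
  case (Cons b bs)
  define y1 where "y1 = y + (h * v b y) *\<^sub>R b"
  have b: "b \<in> Basis" "norm b = 1" and bs: "set bs \<subseteq> Basis"
    using Cons.prems by auto
  have "dist y z \<le> \<rho>"
    using Cons.prems(2) M h by (smt (verit) mult_nonneg_nonneg of_nat_0_le_iff)
  note nr = near[OF b(1) this]
  have "dist y1 z \<le> dist y z + h * M"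
  proof -
    have "dist y1 y = h * \<bar>v b y\<bar>"
      using b h by (simp add: y1_def dist_norm abs_mult)
    also have "\<dots> \<le> h * M"
      using nr h by (intro mult_left_mono) auto
    finally show ?thesis
      using dist_triangle[of y1 z y] by linarith
  qed
  then have "dist y1 z + length bs * (h * M) \<le> \<rho>"
    using Cons.prems(2) by (simp add: algebra_simps)
  note IH = Cons.IH[OF bs this]
  have eq: "pt h (b # bs) y - y - h *\<^sub>R (\<Sum>b\<leftarrow>b # bs. v b z *\<^sub>R b)
      = (pt h bs y1 - y1 - h *\<^sub>R (\<Sum>b\<leftarrow>bs. v b z *\<^sub>R b)) + (h * (v b y - v b z)) *\<^sub>R b"
    by (simp add: y1_def algebra_simps)
  have "norm ((h * (v b y - v b z)) *\<^sub>R b) \<le> h * \<eta>"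
    using nr h b by (simp add: abs_mult)
  then have est: "norm (pt h (b # bs) y - y - h *\<^sub>R (\<Sum>b\<leftarrow>b # bs. v b z *\<^sub>R b)) \<le> length bs * (h * \<eta>) + h * \<eta>"
    unfolding eq using IH by (intro norm_triangle_le) linarith
  define s where "s = h * q b y"
  have s: "\<bar>s\<bar> \<le> h * M"
    using nr h by (simp add: s_def abs_mult)
  then have s2: "2 * s\<^sup>2 \<le> h * \<eta>"
  proof -
    have "s\<^sup>2 \<le> (h * M)\<^sup>2"
      using s by (rule power2_le_iff_abs_le[THEN iffD2, rotated]) (use h M in auto)
    then have "2 * s\<^sup>2 \<le> h * (2 * (h * M\<^sup>2))"
      by (simp add: power2_eq_square algebra_simps)
    also have "\<dots> \<le> h * \<eta>"
      using h by (intro mult_left_mono) auto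
    finally show ?thesis .
  qed
  \<comment> \<open>Valid since \<open>\<bar>s\<bar> \<le> 1/2\<close>; the quadratic term has just
    been absorbed by the smallness of \<open>h\<close>.\<close>
  have "s - 2 * s\<^sup>2 \<le> ln (1 + s)"
    using abs_ln_one_plus_x_minus_x_bound[of s] s h(2) by linarith
  moreover have "h * q b z - h * \<eta> \<le> s"
  proof -
    have "h * (q b z - \<eta>) \<le> h * q b y"
      using nr h by (intro mult_left_mono) auto
    then show ?thesis
      by (simp add: s_def algebra_simps)
  qed
  ultimately have "h * (q b z - 2 * \<eta>) \<le> ln (1 + s)"
    using s2 by (simp add: algebra_simps)
  then have e: "exp (h * (q b z - 2 * \<eta>)) \<le> 1 + s"
    using s h(2) by (subst (asm) ln_ge_iff) auto
  have "exp (h * (q b z - 2 * \<eta>)) * exp (h * (\<Sum>b\<leftarrow>bs. q b z - 2 * \<eta>)) \<le> (1 + s) * wt h bs y1"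
    using IH e by (intro mult_mono) (auto intro: order_trans[OF exp_ge_zero])
  then have "exp (h * (\<Sum>b\<leftarrow>b # bs. q b z - 2 * \<eta>)) \<le> wt h (b # bs) y"
    by (simp add: s_def y1_def exp_add[symmetric] algebra_simps)
  with est show ?case
    using IH nr by (simp add: y1_def algebra_simps)
qed simp

lemma continuous_on_field: "continuous_on UNIV field"
  unfolding field_def by (intro continuous_intros v_cont)

lemma continuous_on_dvg: "continuous_on UNIV dvg"
  unfolding dvg_def by (intro continuous_intros q_cont)

text \<open>One sweep through the basis is an explicit Euler step for \<open>field\<close> up to
  \<open>h * e\<close>, with weight at least that of the divergence up to the same error rate.
  Uniform continuity on the compact \<open>D\<close> makes the step bound independent of the base
  point.\<close>

lemma sweep_uniform:
  assumes D: "compact D" and bl: "set bl = (Basis :: 'a set)" "distinct bl" and e: "e > 0"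
  obtains h0 where "h0 > 0"
    "\<And>h z. 0 < h \<Longrightarrow> h < h0 \<Longrightarrow> cball z 1 \<subseteq> D \<Longrightarrow>
      inside D h bl z \<and> norm (pt h bl z - z - h *\<^sub>R field z) \<le> h * e \<and>
      wt h bl z \<ge> exp (h * (dvg z - e))"
    "\<And>h b x. 0 < h \<Longrightarrow> h < h0 \<Longrightarrow> b \<in> Basis \<Longrightarrow> x \<in> D \<Longrightarrow> 1 + h * q b x \<ge> 0"
proof -
  define n where "n = real (DIM('a))"
  have n: "n > 0" and len: "length bl = n"
    using distinct_card[OF bl(2)] bl(1) by (auto simp: n_def)
  \<comment> \<open>The \<open>n\<close> shears of a sweep lose \<open>2 * \<eta>\<close> each in
    the rate of the weight, which adds up to \<open>e\<close>.\<close>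
  define \<eta> where "\<eta> = e / (2 * n)"
  have \<eta>: "\<eta> > 0" using e n by (simp add: \<eta>_def)
  have "compact (\<Union>b\<in>Basis. v b ` D \<union> q b ` D)"
    using D by (intro compact_UN finite_Basis ballI compact_Un compact_continuous_image
        continuous_on_subset[OF v_cont] continuous_on_subset[OF q_cont]) auto
  then obtain M where M: "M > 0" "\<And>r. r \<in> (\<Union>b\<in>Basis. v b ` D \<union> q b ` D) \<Longrightarrow> norm r \<le> M"
    using compact_imp_bounded bounded_pos by metis
  have bd: "\<bar>v b y\<bar> \<le> M" "\<bar>q b y\<bar> \<le> M" if "b \<in> Basis" "y \<in> D" for b y
    using M(2)[of "v b y"] M(2)[of "q b y"] that by auto
  have "\<exists>d>0. \<forall>y\<in>D. \<forall>z\<in>D. dist y z < d \<longrightarrow> \<bar>v b y - v b z\<bar> \<le> \<eta> \<and> \<bar>q b y - q b z\<bar> \<le> \<eta>"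
    if b: "b \<in> Basis" for b
  proof -
    have "uniformly_continuous_on D (v b)" "uniformly_continuous_on D (q b)"
      using b by (auto intro!: compact_uniformly_continuous D continuous_on_subset[OF v_cont] continuous_on_subset[OF q_cont])
    then obtain d1 d2 where "d1 > 0" "d2 > 0"
      "\<And>y z. y \<in> D \<Longrightarrow> z \<in> D \<Longrightarrow> dist y z < d1 \<Longrightarrow> dist (v b y) (v b z) < \<eta>"
      "\<And>y z. y \<in> D \<Longrightarrow> z \<in> D \<Longrightarrow> dist y z < d2 \<Longrightarrow> dist (q b y) (q b z) < \<eta>"
      using \<eta> unfolding uniformly_continuous_on_def by metis
    then show ?thesis
      by (intro exI[of _ "min d1 d2"]) (auto simp: dist_real_def less_imp_le)
  qed
  then obtain d where d: "\<And>b. b \<in> Basis \<Longrightarrow> d b > 0"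
    "\<And>b y z. b \<in> Basis \<Longrightarrow> y \<in> D \<Longrightarrow> z \<in> D \<Longrightarrow> dist y z < d b \<Longrightarrow> \<bar>v b y - v b z\<bar> \<le> \<eta> \<and> \<bar>q b y - q b z\<bar> \<le> \<eta>"
    by metis
  \<comment> \<open>The bound 1 keeps the sweep in \<open>cball z 1\<close>, hence in
    \<open>D\<close>; the halved minimum stays strictly below every modulus of continuity
    \<open>d b\<close>.\<close>
  define \<rho> where "\<rho> = min 1 (Min (d ` Basis) / 2)"
  have Min0: "Min (d ` Basis) > 0"
    using d(1) by (subst Min_gr_iff) auto
  then have \<rho>: "\<rho> > 0" "\<rho> \<le> 1" by (auto simp: \<rho>_def)
  have \<rho>d: "\<rho> < d b" if "b \<in> Basis" for b
  proof -
    have "Min (d ` Basis) \<le> d b" using that by (intro Min_le) auto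
    with Min0 have "Min (d ` Basis) / 2 < d b" by linarith
    then show ?thesis by (simp add: \<rho>_def min_less_iff_disj)
  qed
  \<comment> \<open>The three bounds keep each factor \<open>1 + h * q b x\<close> at least 1/2, the
    quadratic error below \<eta>, and the whole sweep within \<rho> of its start.\<close>
  define h0 where "h0 = min (1 / (2 * M)) (min (\<eta> / (2 * M\<^sup>2)) (\<rho> / (n * M)))"
  show thesis
  proof
    show "h0 > 0"
      using M(1) \<eta> \<rho> n by (simp add: h0_def)
    fix h assume h: "0 < h" "h < h0"
    then have h1: "h * M \<le> 1/2" "2 * (h * M\<^sup>2) \<le> \<eta>" "n * (h * M) \<le> \<rho>"
      using M(1) n by (auto simp: h0_def field_simps)
    show "inside D h bl z \<and> norm (pt h bl z - z - h *\<^sub>R field z) \<le> h * e \<and> wt h bl z \<ge> exp (h * (dvg z - e))"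
      if zD: "cball z 1 \<subseteq> D" for z
    proof -
      have near: "y \<in> D \<and> \<bar>v b y\<bar> \<le> M \<and> \<bar>q b y\<bar> \<le> M \<and> \<bar>v b y - v b z\<bar> \<le> \<eta> \<and> \<bar>q b y - q b z\<bar> \<le> \<eta>"
        if "b \<in> Basis" "dist y z \<le> \<rho>" for b y
      proof -
        have "z \<in> D" using zD by auto
        moreover have "y \<in> D" using zD \<rho>(2) that(2) by (auto simp: dist_commute)
        ultimately show ?thesis
          using bd[OF that(1)] d(2)[OF that(1), of y z] \<rho>d[OF that(1)] that(2) by auto
      qed
      have "dist z z + real (length bl) * (h * M) \<le> \<rho>"
        using h1(3) len by simp
      note E = sweep_estimate[OF less_imp_le[OF M(1)] h(1) h1(1,2) near equalityD1[OF bl(1)] this]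
      have "(\<Sum>b\<leftarrow>bl. v b z *\<^sub>R b) = field z" "(\<Sum>b\<leftarrow>bl. q b z - 2 * \<eta>) = dvg z - n * (2 * \<eta>)"
        using bl by (auto simp: sum_list_distinct_conv_sum_set field_def dvg_def sum_subtractf n_def)
      moreover have "n * (2 * \<eta>) = e" "n * (h * \<eta>) \<le> h * e"
        using n e h by (auto simp: \<eta>_def)
      ultimately show ?thesis
        using E len by auto
    qed
    show "1 + h * q b x \<ge> 0" if "b \<in> Basis" "x \<in> D" for b x
    proof -
      have "\<bar>h * q b x\<bar> \<le> h * M"
        using bd[OF that] h by (simp add: abs_mult)
      with h1(1) show ?thesis by linarith
    qed
  qed
qed

section \<open>Convergence of the splitting scheme to the flow\<close>

lemma field_lipschitz:
  assumes "compact S" "convex S"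
  obtains L where "L \<ge> 0" "\<And>x y. x \<in> S \<Longrightarrow> y \<in> S \<Longrightarrow> norm (field x - field y) \<le> L * norm (x - y)"
  using v_lipschitz[OF assms] unfolding field_def by blast

text \<open>A substitute for Liouville's formula: \<Psi> is the scheme run for \<open>N\<close>
  steps up to time \<open>T\<close>. Local errors accumulate as in Gronwall's inequality, and the
  product of the weights is close to the exponential of the integrated divergence, so it is at least
  \<open>exp (- C - 1)\<close> on \<open>Q\<close>.\<close>

lemma approx_flow:
  fixes X :: "real \<Rightarrow> 'a \<Rightarrow> 'a"
  assumes K: "compact K" and Q: "compact Q" and T: "T > 0" and e: "e > 0"
    and X0: "\<And>x. x \<in> Q \<Longrightarrow> X 0 x = x"
    and X': "\<And>x t. x \<in> Q \<Longrightarrow> t \<in> {0..T} \<Longrightarrow> ((\<lambda>s. X s x) has_vector_derivative field (X t x)) (at t within {0..T})"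
    and XK: "\<And>x t. x \<in> Q \<Longrightarrow> t \<in> {0..T} \<Longrightarrow> X t x \<in> K"
    and int: "\<And>x. x \<in> Q \<Longrightarrow> integral {0..T} (\<lambda>s. dvg (X s x)) \<ge> - C"
  obtains \<Psi> where "continuous_on UNIV \<Psi>" "\<And>x. x \<in> Q \<Longrightarrow> norm (\<Psi> x - X T x) \<le> e"
    "\<And>f. f \<in> borel_measurable borel \<Longrightarrow>
      ennreal (exp (- C - 1)) * (\<integral>\<^sup>+x. f (\<Psi> x) * indicator Q x \<partial>lborel) \<le> (\<integral>\<^sup>+y. f y \<partial>lborel)"
proof -
  obtain r where r: "r > 0" "\<And>x. x \<in> K \<Longrightarrow> norm x \<le> r"
    using compact_imp_bounded[OF K] bounded_pos by metis
  \<comment> \<open>Exact orbits have norm at most \<open>r\<close>, the scheme stays within 1 of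
    them, and \<open>sweep_uniform\<close> needs a further unit ball.\<close>
  define R where "R = r + 2"
  have R: "R > 0" using r by (simp add: R_def)
  define D where "D = (cbox (- R *\<^sub>R One) (R *\<^sub>R One) :: 'a set)"
  have D: "compact D" "convex D" by (auto simp: D_def)
  have inD: "x \<in> D" if "norm x \<le> R" for x
    unfolding D_def mem_box
  proof
    fix b :: 'a assume b: "b \<in> Basis"
    then have "\<bar>x \<bullet> b\<bar> \<le> R" using Basis_le_norm[OF b, of x] that by linarith
    then show "- R *\<^sub>R One \<bullet> b \<le> x \<bullet> b \<and> x \<bullet> b \<le> R *\<^sub>R One \<bullet> b"
      using b by auto
  qed
  have cb: "cball z 1 \<subseteq> D" if "norm z \<le> r + 1" for z
  proof
    fix y assume "y \<in> cball z 1"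
    then show "y \<in> D"
      using that norm_triangle_ineq[of z "y - z"] by (intro inD) (auto simp: R_def dist_norm norm_minus_commute)
  qed
  have KD: "x \<in> D" if "x \<in> K" for x
    using r(2)[OF that] by (intro inD) (simp add: R_def)
  obtain L where L: "L \<ge> 0" "\<And>x y. x \<in> D \<Longrightarrow> y \<in> D \<Longrightarrow> norm (field x - field y) \<le> L * norm (x - y)"
    using field_lipschitz[OF D] by blast
  have "compact (field ` D)"
    by (intro compact_continuous_image continuous_on_subset[OF continuous_on_field] D) auto
  then obtain M where M: "M > 0" "\<And>x. x \<in> D \<Longrightarrow> norm (field x) \<le> M"
    using compact_imp_bounded bounded_pos by (metis imageI)
  \<comment> \<open>The logarithm of the weight will fall short of the integral by at most
    \<open>3 * c\<close> per unit time, so by 3/4 up to time \<open>T\<close>; this fits into the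
    slack 1 of \<open>exp (- C - 1)\<close>.\<close>
  define c where "c = 1 / (4 * T)"
  have c: "c > 0" using T by (simp add: c_def)
  have "uniformly_continuous_on D dvg"
    by (intro compact_uniformly_continuous D continuous_on_subset[OF continuous_on_dvg]) auto
  then obtain \<delta>' where "\<delta>' > 0" "\<And>x y. x \<in> D \<Longrightarrow> y \<in> D \<Longrightarrow> dist x y < \<delta>' \<Longrightarrow> dist (dvg x) (dvg y) < c"
    using c unfolding uniformly_continuous_on_def by metis
  then obtain \<delta> where \<delta>: "\<delta> > 0" "\<And>x y. x \<in> D \<Longrightarrow> y \<in> D \<Longrightarrow> norm (x - y) \<le> \<delta> \<Longrightarrow> \<bar>dvg x - dvg y\<bar> \<le> c"
    by (metis dense dist_norm dist_real_def less_eq_real_def order_le_less_trans)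
  \<comment> \<open>Being within \<open>tol\<close> of the exact orbit gives the claimed accuracy,
    keeps the scheme in \<open>D\<close>, and changes \<open>dvg\<close> by at most
    \<open>c\<close>.\<close>
  define tol where "tol = min e (min 1 \<delta>)"
  have tol: "tol > 0" using e \<delta> by (simp add: tol_def)
  define \<eta> where "\<eta> = min c (tol / (2 * T * exp (L * T)))"
  have \<eta>: "\<eta> > 0" "\<eta> \<le> c" "2 * \<eta> * T * exp (L * T) \<le> tol"
  proof -
    show "\<eta> > 0" "\<eta> \<le> c"
      using c tol T by (auto simp: \<eta>_def)
    have "\<eta> \<le> tol / (2 * T * exp (L * T))"
      by (simp add: \<eta>_def)
    then show "2 * \<eta> * T * exp (L * T) \<le> tol"
      using T by (simp add: pos_le_divide_eq mult_ac)
  qed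
  obtain bl where bl: "set bl = (Basis :: 'a set)" "distinct bl"
    using finite_distinct_list[OF finite_Basis] by blast
  obtain h0 where h0: "h0 > 0"
    "\<And>h z. 0 < h \<Longrightarrow> h < h0 \<Longrightarrow> cball z 1 \<subseteq> D \<Longrightarrow>
      inside D h bl z \<and> norm (pt h bl z - z - h *\<^sub>R field z) \<le> h * \<eta> \<and>
      wt h bl z \<ge> exp (h * (dvg z - \<eta>))"
    "\<And>h b x. 0 < h \<Longrightarrow> h < h0 \<Longrightarrow> b \<in> Basis \<Longrightarrow> x \<in> D \<Longrightarrow> 1 + h * q b x \<ge> 0"
    using sweep_uniform[OF D(1) bl \<eta>(1)] by metis
  \<comment> \<open>During one step the exact orbit moves by at most \<open>M * h\<close>:
    \<open>field\<close> then varies by at most \<eta> and \<open>dvg\<close> by at most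
    \<open>c\<close>. Using \<open>L + 1\<close> covers the case \<open>L = 0\<close>.\<close>
  define h1 where "h1 = min h0 (min (\<eta> / ((L + 1) * M)) (\<delta> / M))"
  have h1: "h1 > 0" using h0(1) \<eta> \<delta> M L by (simp add: h1_def)
  obtain N where N: "T / h1 < real N"
    using reals_Archimedean2 by blast
  have N0: "N > 0" using N T h1 by (metis divide_pos_pos less_trans of_nat_0_less_iff)
  define h where "h = T / N"
  have h: "h > 0" "h < h1" using T N N0 h1 by (auto simp: h_def field_simps)
  have hs: "h < h0" "L * (M * h) \<le> \<eta>" "M * h \<le> \<delta>"
  proof -
    show "h < h0" "M * h \<le> \<delta>" using h M by (auto simp: h1_def field_simps)
    have "h \<le> \<eta> / ((L + 1) * M)" using h by (auto simp: h1_def)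
    then have "(L + 1) * (M * h) \<le> \<eta>"
      using M L by (subst (asm) pos_le_divide_eq) (auto simp: mult_ac intro!: mult_pos_pos)
    moreover have "L * (M * h) \<le> (L + 1) * (M * h)"
      using M h by (intro mult_right_mono) auto
    ultimately show "L * (M * h) \<le> \<eta>" by linarith
  qed
  have NT: "real N * h = T" using N0 by (simp add: h_def)
  define cs where "cs k = concat (replicate k bl)" for k
  have cs_Suc: "cs (Suc k) = cs k @ bl" for k
    unfolding cs_def by (induction k) auto
  have cs_Basis: "set (cs k) \<subseteq> Basis" for k
    using bl(1) by (induction k) (auto simp: cs_def)

  \<comment> \<open>Local errors of the exact flow: against the Euler step, and of the left-endpoint
    rectangle rule for the integral of \<open>dvg\<close>.\<close>
  have step: "norm (X (t + h) x - X t x - h *\<^sub>R field (X t x)) \<le> h * \<eta>"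
      "integral {t..t + h} (\<lambda>s. dvg (X s x)) \<le> h * (dvg (X t x) + c)"
    if x: "x \<in> Q" and t: "0 \<le> t" "t + h \<le> T" for x t
  proof -
    have der: "((\<lambda>s. X s x) has_vector_derivative field (X s x)) (at s within {t..t'})"
      if "s \<in> {t..t'}" "t' \<le> t + h" for s t'
      using that t by (intro has_vector_derivative_within_subset[OF X'[OF x]]) auto
    have XD: "X s x \<in> D" if "s \<in> {t..t + h}" for s
      using that t by (intro KD XK x) auto
    have dX: "norm (X s x - X t x) \<le> M * h" if s: "s \<in> {t..t + h}" for s
    proof -
      have "norm (X s x - X t x) \<le> M * (s - t)"
        using s t by (intro norm_increment_le[OF _ der]) (auto intro!: M XD)
      also have "\<dots> \<le> M * h"
        using s M by (intro mult_left_mono) auto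
      finally show ?thesis .
    qed
    \<comment> \<open>Subtracting the linear motion with frozen velocity leaves a curve whose speed
      is at most \<eta>.\<close>
    have "norm ((X (t + h) x - (t + h) *\<^sub>R field (X t x)) - (X t x - t *\<^sub>R field (X t x))) \<le> \<eta> * ((t + h) - t)"
    proof (rule norm_increment_le)
      fix s assume s: "s \<in> {t..t + h}"
      show "((\<lambda>s. X s x - s *\<^sub>R field (X t x)) has_vector_derivative field (X s x) - field (X t x)) (at s within {t..t + h})"
        by (auto intro!: derivative_eq_intros der s)
      have "norm (field (X s x) - field (X t x)) \<le> L * (M * h)"
        using L(2)[OF XD[OF s] XD[of t]] dX[OF s] L(1) h by (auto intro: order_trans[OF _ mult_left_mono])
      then show "norm (field (X s x) - field (X t x)) \<le> \<eta>"
        using hs(2) by linarith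
    qed (use h in auto)
    then show "norm (X (t + h) x - X t x - h *\<^sub>R field (X t x)) \<le> h * \<eta>"
      by (simp add: algebra_simps)
    have "continuous_on {t..t + h} (\<lambda>s. X s x)"
      by (rule continuous_on_vector_derivative) (rule der, auto)
    then have "(\<lambda>s. dvg (X s x)) integrable_on {t..t + h}"
      by (intro integrable_continuous_interval continuous_on_compose2[OF continuous_on_dvg]) auto
    moreover have "dvg (X s x) \<le> dvg (X t x) + c" if s: "s \<in> {t..t + h}" for s
      using \<delta>(2)[OF XD[OF s] XD[of t]] dX[OF s] hs(3) h by auto
    ultimately have "integral {t..t + h} (\<lambda>s. dvg (X s x)) \<le> integral {t..t + h} (\<lambda>s. dvg (X t x) + c)"
      by (intro integral_le) auto
    then show "integral {t..t + h} (\<lambda>s. dvg (X s x)) \<le> h * (dvg (X t x) + c)"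
      using h by (simp add: mult.commute)
  qed

  have main: "inside D h (cs k) x \<and> norm (pt h (cs k) x - X (k * h) x) \<le> 2 * \<eta> * (k * h) * exp (L * (k * h)) \<and>
      wt h (cs k) x \<ge> exp (integral {0..k * h} (\<lambda>s. dvg (X s x)) - 3 * c * (k * h))"
    if x: "x \<in> Q" and "k \<le> N" for x k
    using that(2)
  proof (induction k)
    case 0
    then show ?case by (simp add: cs_def X0 x)
  next
    case (Suc k)
    define t where "t = k * h"
    have "real (Suc k) * h \<le> real N * h"
      using Suc.prems h by (intro mult_right_mono) auto
    then have t: "0 \<le> t" "t + h \<le> T"
      using h NT by (auto simp: t_def algebra_simps)
    have th: "real (Suc k) * h = t + h"
      by (simp add: t_def algebra_simps)
    define z where "z = pt h (cs k) x"
    define w where "w = X t x"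
    have IH: "inside D h (cs k) x" "norm (z - w) \<le> 2 * \<eta> * t * exp (L * t)"
      "wt h (cs k) x \<ge> exp (integral {0..t} (\<lambda>s. dvg (X s x)) - 3 * c * t)"
      using Suc by (auto simp: t_def z_def w_def)
    have "2 * \<eta> * t * exp (L * t) \<le> 2 * \<eta> * T * exp (L * T)"
      using t h \<eta> L T by (intro mult_mono) (auto intro!: mult_left_mono)
    then have zw: "norm (z - w) \<le> tol"
      using IH(2) \<eta>(3) by linarith
    have wK: "w \<in> K" using t h by (auto simp: w_def intro!: XK x)
    then have wD: "w \<in> D" by (rule KD)
    have "norm z \<le> r + 1"
      using r(2)[OF wK] zw norm_triangle_ineq[of w "z - w"] by (auto simp: tol_def)
    then have cbz: "cball z 1 \<subseteq> D" by (rule cb)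
    then have zD: "z \<in> D" by auto
    note S = h0(2)[OF h(1) hs(1) cbz]
    note F = step[OF x t]
    \<comment> \<open>The new error splits into the old one, the local errors of sweep and flow, and
      the difference of the Euler steps from \<open>z\<close> and \<open>w\<close>.\<close>
    have "norm (pt h bl z - X (t + h) x)
        \<le> norm (z - w) + norm (pt h bl z - z - h *\<^sub>R field z) + norm (X (t + h) x - w - h *\<^sub>R field w) + norm (h *\<^sub>R (field z - field w))"
    proof -
      have "pt h bl z - X (t + h) x = (z - w) + (pt h bl z - z - h *\<^sub>R field z) - (X (t + h) x - w - h *\<^sub>R field w) + h *\<^sub>R (field z - field w)"
        by (simp add: algebra_simps)
      moreover have "norm (a + b - c + d) \<le> norm a + norm b + norm c + norm d" for a b c d :: 'a
        using norm_triangle_ineq[of "a + b - c" d] norm_triangle_ineq4[of "a + b" c] norm_triangle_ineq[of a b]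
        by linarith
      ultimately show ?thesis
        by presburger
    qed
    also have "\<dots> \<le> (1 + L * h) * norm (z - w) + 2 * \<eta> * h"
    proof -
      have "norm (h *\<^sub>R (field z - field w)) \<le> h * (L * norm (z - w))"
        using L(2)[OF zD wD] h by simp
      then show ?thesis
        using S F(1) by (simp add: w_def algebra_simps)
    qed
    \<comment> \<open>Discrete Gronwall: \<open>1 + L * h \<le> exp (L * h)\<close>, and the fresh
      error is inflated by a factor at least 1 so that the sum has the closed form required.\<close>
    also have "\<dots> \<le> exp (L * h) * (2 * \<eta> * t * exp (L * t)) + 2 * \<eta> * h * exp (L * (t + h))"
    proof (rule add_mono)
      show "(1 + L * h) * norm (z - w) \<le> exp (L * h) * (2 * \<eta> * t * exp (L * t))"
        using IH(2) by (intro mult_mono) auto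
      have "2 * \<eta> * h * 1 \<le> 2 * \<eta> * h * exp (L * (t + h))"
        using \<eta> h L t by (intro mult_left_mono) auto
      then show "2 * \<eta> * h \<le> 2 * \<eta> * h * exp (L * (t + h))" by simp
    qed
    also have "\<dots> = 2 * \<eta> * (t + h) * exp (L * (t + h))"
      by (simp add: algebra_simps exp_add)
    finally have A: "norm (pt h bl z - X (t + h) x) \<le> 2 * \<eta> * (t + h) * exp (L * (t + h))" .
    have "continuous_on {0..t + h} (\<lambda>s. X s x)"
      by (rule continuous_on_vector_derivative, rule has_vector_derivative_within_subset[OF X'[OF x]])
        (use t in auto)
    then have "(\<lambda>s. dvg (X s x)) integrable_on {0..t + h}"
      by (intro integrable_continuous_interval continuous_on_compose2[OF continuous_on_dvg]) auto
    then have I: "integral {0..t + h} (\<lambda>s. dvg (X s x)) = integral {0..t} (\<lambda>s. dvg (X s x)) + integral {t..t + h} (\<lambda>s. dvg (X s x))"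
      using t h by (intro Henstock_Kurzweil_Integration.integral_combine[symmetric]) auto
    have "dvg w \<le> dvg z + c"
      using \<delta>(2)[OF zD wD] zw by (auto simp: tol_def)
    \<comment> \<open>The three losses of \<open>c\<close>: the rectangle rule, the passage from the
      exact point \<open>w\<close> to the computed \<open>z\<close>, and the sweep error
      \<open>\<eta> \<le> c\<close>.\<close>
    then have "h * (dvg w + c) \<le> h * (dvg z - \<eta> + 3 * c)"
      using h \<eta>(2) by (intro mult_left_mono) auto
    then have "integral {t..t + h} (\<lambda>s. dvg (X s x)) - 3 * c * h \<le> h * (dvg z - \<eta>)"
      using F(2) by (simp add: w_def algebra_simps)
    then have "exp (integral {t..t + h} (\<lambda>s. dvg (X s x)) - 3 * c * h) \<le> wt h bl z"
      using S by (meson exp_le_cancel_iff order_trans)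
    then have "exp (integral {0..t} (\<lambda>s. dvg (X s x)) - 3 * c * t) * exp (integral {t..t + h} (\<lambda>s. dvg (X s x)) - 3 * c * h)
        \<le> wt h (cs k) x * wt h bl z"
      using IH(3) by (intro mult_mono) (auto intro: order_trans[OF exp_ge_zero])
    then have "exp (integral {0..t + h} (\<lambda>s. dvg (X s x)) - 3 * c * (t + h)) \<le> wt h (cs (Suc k)) x"
      unfolding cs_Suc wt_append z_def[symmetric] I by (simp add: exp_add[symmetric] algebra_simps)
    then show ?case
      unfolding th using A IH(1) S by (simp add: cs_Suc pt_append inside_append z_def)
  qed
  show thesis
  proof
    show "continuous_on UNIV (pt h (cs N))"
      by (intro continuous_on_pt cs_Basis)
    show "norm (pt h (cs N) x - X T x) \<le> e" if "x \<in> Q" for x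
      using main[OF that order_refl] \<eta>(3) by (simp add: NT tol_def)
    show "ennreal (exp (- C - 1)) * (\<integral>\<^sup>+x. f (pt h (cs N) x) * indicator Q x \<partial>lborel) \<le> (\<integral>\<^sup>+y. f y \<partial>lborel)"
      if f[measurable]: "f \<in> borel_measurable borel" for f
    proof -
      have [measurable]: "pt h (cs N) \<in> borel_measurable borel" "Q \<in> sets borel"
        using continuous_on_pt[OF cs_Basis] Q by (auto intro: borel_measurable_continuous_onI simp: borel_compact)
      have w: "exp (- C - 1) \<le> wt h (cs N) x" if "x \<in> Q" for x
      proof -
        have "exp (- C - 1) \<le> exp (integral {0..T} (\<lambda>s. dvg (X s x)) - 3 * c * T)"
          using int[OF that] T by (simp add: c_def)
        also have "\<dots> \<le> wt h (cs N) x"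
          using main[OF that order_refl] by (simp add: NT)
        finally show ?thesis .
      qed
      have "ennreal (exp (- C - 1)) * (\<integral>\<^sup>+x. f (pt h (cs N) x) * indicator Q x \<partial>lborel)
          = (\<integral>\<^sup>+x. ennreal (exp (- C - 1)) * (f (pt h (cs N) x) * indicator Q x) \<partial>lborel)"
        by (intro nn_integral_cmult[symmetric]) measurable
      also have "\<dots> \<le> (\<integral>\<^sup>+x. f (pt h (cs N) x) * ennreal (wt h (cs N) x) * indicator Q x \<partial>lborel)"
      proof (rule nn_integral_mono)
        fix x
        have "ennreal (exp (- C - 1)) * f (pt h (cs N) x) \<le> ennreal (wt h (cs N) x) * f (pt h (cs N) x)" if "x \<in> Q"
          using w[OF that] by (intro mult_right_mono ennreal_leI) auto
        then show "ennreal (exp (- C - 1)) * (f (pt h (cs N) x) * indicator Q x)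
            \<le> f (pt h (cs N) x) * ennreal (wt h (cs N) x) * indicator Q x"
          by (auto simp: mult.commute split: split_indicator)
      qed
      also have "\<dots> \<le> (\<integral>\<^sup>+y. f y \<partial>lborel)"
        using h0(3)[OF h(1) hs(1)] main[OF _ order_refl] Q
        by (intro nn_integral_pt_le[OF f R]) (auto simp: cs_Basis[THEN subsetD] D_def)
      finally show ?thesis .
    qed
  qed
qed

end

subsection \<open>Gradient flows\<close>

lemma has_derivative_grad:
  assumes "u differentiable (at x)"
  shows "(u has_derivative (\<lambda>h. grad u x \<bullet> h)) (at x)"
proof -
  have D: "(u has_derivative frechet_derivative u (at x)) (at x)"
    using assms by (simp add: frechet_derivative_works)
  interpret bounded_linear "frechet_derivative u (at x)"
    using D by (rule has_derivative_bounded_linear)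
  have "frechet_derivative u (at x) h = grad u x \<bullet> h" for h
  proof -
    have "frechet_derivative u (at x) h = frechet_derivative u (at x) (\<Sum>b\<in>Basis. (h \<bullet> b) *\<^sub>R b)"
      by (simp add: euclidean_representation)
    also have "\<dots> = grad u x \<bullet> h"
      by (simp add: sum scaleR grad_def pderiv_dir_def inner_sum_left mult.commute) (simp add: inner_commute)
    finally show ?thesis .
  qed
  with D show ?thesis
    by (simp add: has_derivative_eq_rhs ext)
qed

text \<open>Along the orbit \<open>u\<close> grows at rate \<open>(norm (grad u))\<^sup>2\<close>
  but stays bounded on \<open>K\<close>. Every late excursion to distance \<delta> from
  \<open>p\<close> would raise \<open>u\<close> by a fixed amount, more than is left below its
  supremum.\<close>

lemma gradient_flow_tendsto:
  fixes u :: "'a::euclidean_space \<Rightarrow> real"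
  assumes u: "\<And>x. u differentiable (at x)" and gc: "continuous_on UNIV (grad u)"
    and K: "compact K" "\<And>y. y \<in> K \<Longrightarrow> grad u y = 0 \<Longrightarrow> y = p"
    and Y': "\<And>t. t \<ge> 0 \<Longrightarrow> (Y has_vector_derivative grad u (Y t)) (at t within {0..})"
    and YK: "\<And>t. t \<ge> 0 \<Longrightarrow> Y t \<in> K"
  shows "(Y \<longlongrightarrow> p) at_top"
proof (rule tendstoI)
  fix \<delta> :: real assume \<delta>: "\<delta> > 0"
  have "compact (grad u ` K)"
    by (intro compact_continuous_image continuous_on_subset[OF gc] K(1)) auto
  then obtain M where M: "M > 0" "\<And>x. x \<in> K \<Longrightarrow> norm (grad u x) \<le> M"
    using compact_imp_bounded bounded_pos by (metis imageI)
  have "continuous_on UNIV u"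
    using u by (intro continuous_at_imp_continuous_on) (auto intro: differentiable_imp_continuous_within)
  then have "compact (u ` K)"
    by (intro compact_continuous_image K(1)) (auto intro: continuous_on_subset)
  then obtain B where B: "\<And>x. x \<in> K \<Longrightarrow> norm (u x) \<le> B"
    using compact_imp_bounded bounded_pos by (metis imageI)
  define g where "g t = u (Y t)" for t
  have g': "(g has_derivative (\<lambda>h. h * (norm (grad u (Y t)))\<^sup>2)) (at t within {a..b})"
    if "0 \<le> a" "t \<in> {a..b}" for t a b
  proof -
    have "(Y has_derivative (\<lambda>h. h *\<^sub>R grad u (Y t))) (at t within {a..b})"
      using that has_vector_derivative_within_subset[OF Y', of t "{a..b}"]
      by (auto simp: has_vector_derivative_def)
    from has_derivative_compose[OF this has_derivative_grad[OF u]]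
    show ?thesis
      unfolding g_def by (rule has_derivative_eq_rhs) (auto simp: dot_square_norm)
  qed
  have g_mvt: "\<exists>s\<in>{a<..<b}. g b - g a = (b - a) * (norm (grad u (Y s)))\<^sup>2" if "0 \<le> a" "a < b" for a b
    by (rule mvt_simple[OF that(2)]) (use that g' in auto)
  have g_mono: "g a \<le> g b" if "0 \<le> a" "a \<le> b" for a b
  proof (cases "a = b")
    case False
    with that obtain s where "g b - g a = (b - a) * (norm (grad u (Y s)))\<^sup>2"
      using g_mvt[of a b] by auto
    moreover have "(b - a) * (norm (grad u (Y s)))\<^sup>2 \<ge> 0"
      using that by simp
    ultimately show ?thesis by linarith
  qed simp
  obtain m where m: "m > 0" "\<And>x. x \<in> K - ball p (\<delta> / 2) \<Longrightarrow> m \<le> norm (grad u x)"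
  proof (cases "K - ball p (\<delta> / 2) = {}")
    case True
    then show ?thesis by (intro that[of 1]) auto
  next
    case False
    have "compact (K - ball p (\<delta> / 2))"
      by (intro compact_diff K(1)) auto
    moreover have "continuous_on (K - ball p (\<delta> / 2)) (\<lambda>x. norm (grad u x))"
      by (intro continuous_intros continuous_on_subset[OF gc]) auto
    ultimately obtain x where x: "x \<in> K - ball p (\<delta> / 2)"
      "\<And>y. y \<in> K - ball p (\<delta> / 2) \<Longrightarrow> norm (grad u x) \<le> norm (grad u y)"
      using continuous_attains_inf[OF _ False] by blast
    moreover have "grad u x \<noteq> 0"
      using x(1) K(2)[of x] \<delta> by auto
    ultimately show ?thesis using that[of "norm (grad u x)"] by auto
  qed
  \<comment> \<open>At speed at most \<open>M\<close>, an orbit at distance \<delta> from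
    \<open>p\<close> stays outside the ball of radius \<open>\<delta> / 2\<close> for time \<tau>,
    gaining at least \<open>m\<^sup>2 * \<tau>\<close>; the time \<open>t0\<close> below is chosen
    so that less than this remains.\<close>
  define \<tau> where "\<tau> = \<delta> / (2 * M)"
  have \<tau>: "\<tau> > 0" "M * \<tau> = \<delta> / 2" using M \<delta> by (auto simp: \<tau>_def)
  have bdd: "bdd_above (g ` {0..})"
    using B YK by (intro bdd_aboveI[of _ B]) (force simp: g_def abs_le_iff)
  have "Sup (g ` {0..}) - m\<^sup>2 * \<tau> < Sup (g ` {0..})"
    using m \<tau> by simp
  then obtain t0 where t0: "t0 \<ge> 0" "Sup (g ` {0..}) - m\<^sup>2 * \<tau> < g t0"
    using less_cSup_iff[OF _ bdd] by auto
  have "dist (Y t) p < \<delta>" if t: "t \<ge> t0" for t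
  proof (rule ccontr)
    assume far: "\<not> dist (Y t) p < \<delta>"
    have "t \<ge> 0" using t t0 by simp
    then obtain s where s: "s \<in> {t<..<t + \<tau>}" "g (t + \<tau>) - g t = \<tau> * (norm (grad u (Y s)))\<^sup>2"
      using g_mvt[of t "t + \<tau>"] \<tau> by auto
    have "norm (Y s - Y t) \<le> M * (s - t)"
    proof (rule norm_increment_le)
      fix r assume "r \<in> {t..s}"
      then show "(Y has_vector_derivative grad u (Y r)) (at r within {t..s})" "norm (grad u (Y r)) \<le> M"
        using \<open>t \<ge> 0\<close> by (auto intro!: M YK has_vector_derivative_within_subset[OF Y'])
    qed (use s in auto)
    also have "\<dots> \<le> M * \<tau>"
      using s M by (intro mult_left_mono) auto
    finally have "dist p (Y s) \<ge> \<delta> / 2"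
      using far dist_triangle[of "Y t" p "Y s"] \<tau>(2) by (auto simp: dist_norm norm_minus_commute)
    then have "m \<le> norm (grad u (Y s))"
      using s \<open>t \<ge> 0\<close> by (intro m(2)) (auto intro: YK)
    then have "\<tau> * m\<^sup>2 \<le> g (t + \<tau>) - g t"
      unfolding s(2) using \<tau> m by (intro mult_left_mono power_mono) auto
    moreover have "g (t + \<tau>) \<le> Sup (g ` {0..})"
      using \<open>t \<ge> 0\<close> \<tau> by (intro cSup_upper bdd) auto
    moreover have "g t0 \<le> g t"
      using t t0 by (intro g_mono) auto
    ultimately show False
      using t0(2) by (simp add: mult.commute)
  qed
  then show "\<forall>\<^sub>F t in at_top. dist (Y t) p < \<delta>"
    by (auto simp: eventually_at_top_linorder)
qed

section \<open>The gradient of a C^2 function as a \<open>c1_field\<close>\<close>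

lemma continuous_on_grad:
  "(\<And>b. b \<in> Basis \<Longrightarrow> continuous_on S (pderiv_dir u b)) \<Longrightarrow> continuous_on S (grad u)"
  unfolding grad_def by (intro continuous_intros)

lemma c1_field_gradient:
  assumes "C2 u"
  shows "c1_field (pderiv_dir u) (\<lambda>b. pderiv_dir (pderiv_dir u b) b)"
proof
  let ?v = "pderiv_dir u"
  have dv: "?v b differentiable (at x)" if "b \<in> Basis" for b x
    using assms that by (auto simp: C2_def)
  have cq: "continuous_on UNIV (pderiv_dir (?v b) c)" if "b \<in> Basis" "c \<in> Basis" for b c
    using assms that by (auto simp: C2_def)
  show "continuous_on UNIV (?v b)" if "b \<in> Basis" for b
    using dv[OF that] by (intro continuous_at_imp_continuous_on) (auto intro: differentiable_imp_continuous_within)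
  show "continuous_on UNIV (pderiv_dir (?v b) b)" if "b \<in> Basis" for b
    using cq that by auto
  show "((\<lambda>t. ?v b (x + t *\<^sub>R b)) has_real_derivative pderiv_dir (?v b) b (x + t *\<^sub>R b)) (at t)"
    if b: "b \<in> Basis" for b x t
  proof -
    have "((\<lambda>t. x + t *\<^sub>R b) has_derivative (\<lambda>h. h *\<^sub>R b)) (at t)"
      by (auto intro!: derivative_eq_intros)
    from has_derivative_compose[OF this has_derivative_grad[OF dv[OF b]]]
    show ?thesis
      unfolding has_field_derivative_def
      by (rule has_derivative_eq_rhs)
        (use b in \<open>simp add: fun_eq_iff grad_def[of "?v b"] inner_sum_left inner_Basis if_distrib cong: if_cong\<close>)
  qed
  show "\<exists>L\<ge>0. \<forall>x\<in>S. \<forall>y\<in>S. norm ((\<Sum>b\<in>Basis. ?v b x *\<^sub>R b) - (\<Sum>b\<in>Basis. ?v b y *\<^sub>R b)) \<le> L * norm (x - y)"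
    if S: "compact S" "convex S" for S
  proof -
    \<comment> \<open>\<open>B x\<close> is a continuous bound for the operator norm of the Hessian
      at \<open>x\<close>; its maximum on \<open>S\<close> is the Lipschitz constant.\<close>
    define B where "B x = (\<Sum>b\<in>Basis. norm (grad (?v b) x))" for x
    have "continuous_on UNIV B"
      unfolding B_def by (intro continuous_intros continuous_on_grad cq)
    then have "compact (B ` S)"
      by (intro compact_continuous_image S) (auto intro: continuous_on_subset)
    then obtain L where L: "L > 0" "\<And>x. x \<in> S \<Longrightarrow> norm (B x) \<le> L"
      using compact_imp_bounded bounded_pos by (metis imageI)
    have "norm ((\<Sum>b\<in>Basis. ?v b x *\<^sub>R b) - (\<Sum>b\<in>Basis. ?v b y *\<^sub>R b)) \<le> L * norm (x - y)"
      if xy: "x \<in> S" "y \<in> S" for x y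
    proof (rule differentiable_bound[OF S(2) _ _ xy, where f = "\<lambda>x. \<Sum>b\<in>Basis. ?v b x *\<^sub>R b"
          and f' = "\<lambda>z h. \<Sum>b\<in>Basis. (grad (?v b) z \<bullet> h) *\<^sub>R b"])
      fix z assume z: "z \<in> S"
      show "((\<lambda>x. \<Sum>b\<in>Basis. ?v b x *\<^sub>R b) has_derivative (\<lambda>h. \<Sum>b\<in>Basis. (grad (?v b) z \<bullet> h) *\<^sub>R b)) (at z within S)"
        by (rule has_derivative_at_withinI, rule has_derivative_sum, rule has_derivative_scaleR_left,
            rule has_derivative_grad, rule dv)
      show "onorm (\<lambda>h. \<Sum>b\<in>Basis. (grad (?v b) z \<bullet> h) *\<^sub>R b) \<le> L"
      proof (rule onorm_bound)
        fix h
        have "norm (\<Sum>b\<in>Basis. (grad (?v b) z \<bullet> h) *\<^sub>R b) \<le> (\<Sum>b\<in>Basis. norm (grad (?v b) z) * norm h)"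
          by (rule sum_norm_le) (auto simp: Cauchy_Schwarz_ineq2)
        also have "\<dots> = B z * norm h"
          by (simp add: B_def sum_distrib_right)
        also have "\<dots> \<le> L * norm h"
          using L(2)[OF z] by (intro mult_right_mono) auto
        finally show "norm (\<Sum>b\<in>Basis. (grad (?v b) z \<bullet> h) *\<^sub>R b) \<le> L * norm h" .
      qed (use L in auto)
    qed
    then show ?thesis using L(1) by (intro exI[of _ L]) auto
  qed
qed

text \<open>If every integral were at least \<open>- C\<close>, the approximations of the flow would
  keep a fixed fraction of the volume of a ball around \<open>p\<close>, although they converge
  pointwise to \<open>p\<close> there. Fatou's lemma turns this into a contradiction.\<close>

lemma gradient_flow_integral_laplacian_unbounded:
  fixes u :: "'a::euclidean_space \<Rightarrow> real"
  assumes u: "C2 u" and K: "compact K" "\<And>y. y \<in> K \<Longrightarrow> grad u y = 0 \<Longrightarrow> y = p" and p: "p \<in> interior Q"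
    and X0: "\<And>x. x \<in> Q \<Longrightarrow> X 0 x = x"
    and X': "\<And>x t. x \<in> Q \<Longrightarrow> t \<ge> 0 \<Longrightarrow> ((\<lambda>s. X s x) has_vector_derivative grad u (X t x)) (at t within {0..})"
    and XK: "\<And>x t. x \<in> Q \<Longrightarrow> t \<ge> 0 \<Longrightarrow> X t x \<in> K"
  shows "\<exists>x\<in>Q. \<exists>t\<ge>0. integral {0..t} (\<lambda>s. laplacian u (X s x)) < - C"
proof (rule ccontr)
  assume contr: "\<not> ?thesis"
  interpret c1_field "pderiv_dir u" "\<lambda>b. pderiv_dir (pderiv_dir u b) b"
    using u by (rule c1_field_gradient)
  have field: "field = grad u" and dvg: "dvg = laplacian u"
    by (auto simp: fun_eq_iff field_def dvg_def grad_def laplacian_def)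
  obtain r where r: "r > 0" "cball p r \<subseteq> Q"
    using p by (meson mem_interior_cball)
  \<comment> \<open>The time \<open>Suc n\<close> tends to infinity while the error
    \<open>1 / Suc n\<close> tends to 0, so one sequence captures both limits; the shift keeps the
    time positive.\<close>
  define approx where "approx n \<Psi> \<longleftrightarrow> continuous_on UNIV \<Psi> \<and>
    (\<forall>x\<in>cball p r. norm (\<Psi> x - X (Suc n) x) \<le> 1 / Suc n) \<and>
    (\<forall>f\<in>borel_measurable borel.
      ennreal (exp (- C - 1)) * (\<integral>\<^sup>+x. f (\<Psi> x) * indicator (cball p r) x \<partial>lborel) \<le> (\<integral>\<^sup>+y. f y \<partial>lborel))" for n \<Psi>
  have "\<exists>\<Psi>. approx n \<Psi>" for n
  proof (rule approx_flow[OF K(1), where Q = "cball p r" and T = "Suc n" and e = "1 / Suc n" and X = X and C = C])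
    fix x assume "x \<in> cball p r"
    then have x: "x \<in> Q" using r by auto
    show "X 0 x = x" by (rule X0[OF x])
    show "- C \<le> integral {0..real (Suc n)} (\<lambda>s. dvg (X s x))"
      using contr x unfolding dvg by (meson not_less of_nat_0_le_iff)
    fix t assume "t \<in> {0..real (Suc n)}"
    then show "X t x \<in> K" "((\<lambda>s. X s x) has_vector_derivative field (X t x)) (at t within {0..real (Suc n)})"
      unfolding field by (auto intro!: XK x has_vector_derivative_within_subset[OF X'[OF x]])
  next
    fix \<Psi> assume "continuous_on UNIV \<Psi>"
      "\<And>x. x \<in> cball p r \<Longrightarrow> norm (\<Psi> x - X (real (Suc n)) x) \<le> 1 / real (Suc n)"
      "\<And>f. f \<in> borel_measurable borel \<Longrightarrow>
        ennreal (exp (- C - 1)) * (\<integral>\<^sup>+x. f (\<Psi> x) * indicator (cball p r) x \<partial>lborel) \<le> (\<integral>\<^sup>+y. f y \<partial>lborel)"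
    then show "\<exists>\<Psi>. approx n \<Psi>"
      unfolding approx_def by blast
  qed auto
  then obtain \<Psi> where "\<And>n. approx n (\<Psi> n)"
    by metis
  then have \<Psi>: "\<And>n. continuous_on UNIV (\<Psi> n)"
    "\<And>n x. x \<in> cball p r \<Longrightarrow> norm (\<Psi> n x - X (Suc n) x) \<le> 1 / Suc n"
    "\<And>n f. f \<in> borel_measurable borel \<Longrightarrow>
      ennreal (exp (- C - 1)) * (\<integral>\<^sup>+x. f (\<Psi> n x) * indicator (cball p r) x \<partial>lborel) \<le> (\<integral>\<^sup>+y. f y \<partial>lborel)"
    by (auto simp only: approx_def)
  have [measurable]: "\<Psi> n \<in> borel_measurable borel" for n
    by (intro borel_measurable_continuous_onI \<Psi>(1))
  have lim: "(\<lambda>n. \<Psi> n x) \<longlonglongrightarrow> p" if x: "x \<in> cball p r" for x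
  proof -
    have xQ: "x \<in> Q" using x r by auto
    have "((\<lambda>t. X t x) \<longlongrightarrow> p) at_top"
    proof (rule gradient_flow_tendsto[OF _ _ K])
      show "continuous_on UNIV (grad u)"
        using continuous_on_field by (simp add: field)
    qed (use u X' XK xQ in \<open>auto simp: C2_def\<close>)
    then have "(\<lambda>n. X (real n) x) \<longlonglongrightarrow> p"
      by (rule filterlim_compose[OF _ filterlim_real_sequentially])
    then have "(\<lambda>n. X (real (Suc n)) x) \<longlonglongrightarrow> p"
      by (subst filterlim_sequentially_Suc)
    moreover have "(\<lambda>n. \<Psi> n x - X (real (Suc n)) x) \<longlonglongrightarrow> 0"
      by (rule Lim_null_comparison[OF _ lim_1_over_n[THEN filterlim_sequentially_Suc[THEN iffD2]]])
        (use \<Psi>(2)[OF x] in auto)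
    ultimately show ?thesis
      using tendsto_add by fastforce
  qed
  have vol: "ennreal (exp (- C - 1)) * emeasure lborel (cball p r) \<le> emeasure lborel (ball p \<epsilon>)" if \<epsilon>: "\<epsilon> > 0" for \<epsilon>
  proof -
    \<comment> \<open>The volume inequality is tested with the indicator of a small ball. On
      \<open>cball p r\<close> the points \<open>\<Psi> n x\<close> eventually enter it, so
      \<open>w n x\<close> eventually equals the constant factor, and Fatou applies.\<close>
    define w where "w n x = ennreal (exp (- C - 1)) * (indicator (ball p \<epsilon>) (\<Psi> n x) * indicator (cball p r) x)" for n x
    have [measurable]: "ball p \<epsilon> \<in> sets borel" "cball p r \<in> sets borel"
      by auto
    have [measurable]: "w n \<in> borel_measurable borel" for n
      unfolding w_def by measurable
    have "ennreal (exp (- C - 1)) * emeasure lborel (cball p r)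
        = (\<integral>\<^sup>+x. ennreal (exp (- C - 1)) * indicator (cball p r) x \<partial>lborel)"
      by (simp add: nn_integral_cmult_indicator)
    also have "\<dots> \<le> (\<integral>\<^sup>+x. liminf (\<lambda>n. w n x) \<partial>lborel)"
    proof (intro nn_integral_mono Liminf_bounded)
      fix x
      show "\<forall>\<^sub>F n in sequentially. ennreal (exp (- C - 1)) * indicator (cball p r) x \<le> w n x"
      proof (cases "x \<in> cball p r")
        case True
        from tendstoD[OF lim[OF True] \<epsilon>] show ?thesis
          by eventually_elim (simp add: w_def dist_commute)
      qed (simp add: w_def)
    qed
    also have "\<dots> \<le> liminf (\<lambda>n. \<integral>\<^sup>+x. w n x \<partial>lborel)"
      by (rule nn_integral_liminf) simp
    also have "\<dots> \<le> limsup (\<lambda>n. \<integral>\<^sup>+x. w n x \<partial>lborel)"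
      by (rule Liminf_le_Limsup) simp
    also have "\<dots> \<le> emeasure lborel (ball p \<epsilon>)"
    proof (intro Limsup_bounded always_eventually allI)
      fix n
      have "(\<integral>\<^sup>+x. w n x \<partial>lborel)
          = ennreal (exp (- C - 1)) * (\<integral>\<^sup>+x. indicator (ball p \<epsilon>) (\<Psi> n x) * indicator (cball p r) x \<partial>lborel)"
        unfolding w_def by (intro nn_integral_cmult) measurable
      also have "\<dots> \<le> (\<integral>\<^sup>+y. indicator (ball p \<epsilon>) y \<partial>lborel)"
        by (intro \<Psi>(3)) measurable
      finally show "(\<integral>\<^sup>+x. w n x \<partial>lborel) \<le> emeasure lborel (ball p \<epsilon>)" by simp
    qed
    finally show ?thesis .
  qed
  define d where "d = DIM('a)"
  define k where "k = exp (- C - 1) * r ^ d"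
  \<comment> \<open>Since \<open>\<epsilon> \<le> 1\<close> and \<open>d \<ge> 1\<close>,
    \<open>\<epsilon> ^ d \<le> \<epsilon> < k\<close>, against the bound
    \<open>k \<le> \<epsilon> ^ d\<close> from the volumes.\<close>
  define \<epsilon> where "\<epsilon> = min 1 (k / 2)"
  have k: "k > 0" using r by (simp add: k_def)
  have \<epsilon>: "\<epsilon> > 0" "\<epsilon> \<le> 1" "\<epsilon> < k" using k by (auto simp: \<epsilon>_def)
  have "\<epsilon> ^ d \<le> \<epsilon> ^ 1"
    using \<epsilon> by (intro power_decreasing) (auto simp: d_def Suc_leI)
  then have "\<epsilon> ^ d < k" using \<epsilon> by simp
  moreover have "ennreal (exp (- C - 1) * (unit_ball_vol d * r ^ d)) \<le> ennreal (unit_ball_vol d * \<epsilon> ^ d)"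
    using vol[OF \<epsilon>(1)] r \<epsilon> by (simp add: emeasure_ball emeasure_cball d_def ennreal_mult)
  then have "unit_ball_vol d * k \<le> unit_ball_vol d * \<epsilon> ^ d"
    using \<epsilon> by (subst (asm) ennreal_le_iff) (auto simp: k_def mult_ac)
  then have "k \<le> \<epsilon> ^ d"
    using unit_ball_vol_pos[of d] by simp
  ultimately show False by simp
qed

section \<open>Passing from \<open>u\<close> to \<open>- u\<close>, for time reversal\<close>

lemma pderiv_dir_minus:
  assumes "\<And>x. u differentiable (at x)"
  shows "pderiv_dir (\<lambda>x. - u x) b = (\<lambda>x. - pderiv_dir u b x)"
proof
  fix x
  have "((\<lambda>x. - u x) has_derivative (\<lambda>h. - frechet_derivative u (at x) h)) (at x)"
    using assms by (intro has_derivative_minus) (simp add: frechet_derivative_works[symmetric])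
  from frechet_derivative_at[OF this] show "pderiv_dir (\<lambda>x. - u x) b x = - pderiv_dir u b x"
    unfolding pderiv_dir_def by metis
qed

lemma
  assumes "C2 u"
  shows C2_minus: "C2 (\<lambda>x. - u x)"
    and grad_minus: "grad (\<lambda>x. - u x) x = - grad u x"
    and laplacian_minus: "laplacian (\<lambda>x. - u x) x = - laplacian u x"
proof -
  have u: "u differentiable (at x)" for x
    using assms by (simp add: C2_def)
  have v: "pderiv_dir u b differentiable (at x)" if "b \<in> Basis" for b x
    using assms that by (simp add: C2_def)
  have 1: "pderiv_dir (\<lambda>x. - u x) b = (\<lambda>x. - pderiv_dir u b x)" for b
    by (rule pderiv_dir_minus[OF u])
  have 2: "pderiv_dir (\<lambda>x. - pderiv_dir u b x) c = (\<lambda>x. - pderiv_dir (pderiv_dir u b) c x)" if "b \<in> Basis" for b c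
    by (rule pderiv_dir_minus[OF v[OF that]])
  show "C2 (\<lambda>x. - u x)"
    using assms by (auto simp: C2_def 1 2 intro!: continuous_intros)
  show "grad (\<lambda>x. - u x) x = - grad u x"
    by (simp add: grad_def 1 sum_negf)
  show "laplacian (\<lambda>x. - u x) x = - laplacian u x"
    by (simp add: laplacian_def 1 2 sum_negf)
qed

theorem theorem3p3:
  fixes u :: "'a::euclidean_space \<Rightarrow> real"
    and X :: "real \<Rightarrow> 'a \<Rightarrow> 'a"
    and xs :: 'a
    and K Q :: "'a set"
    and C :: real
  assumes dim: "DIM('a) \<ge> 2"
    and u_C2: "C2 u"
    and crit: "grad u xs = 0"
    and lap0: "laplacian u xs = 0"
    and K_compact: "compact K"
    and K_nbhd: "xs \<in> interior K"
    and K_isolated: "\<forall>y\<in>K. grad u y = 0 \<longrightarrow> y = xs"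
    and Q_nbhd: "xs \<in> interior Q"
    and Q_sub: "Q \<subseteq> interior K"
    and C_pos: "C > 0"
  shows
    "((\<forall>x\<in>Q. X 0 x = x \<and>
         (\<forall>t\<ge>0. ((\<lambda>s. X s x) has_vector_derivative grad u (X t x)) (at t within {0..})))
      \<and> (\<forall>x\<in>Q. \<forall>t\<ge>0. X t x \<in> K)
      \<and> (\<forall>x\<in>Q. \<forall>t\<ge>0. \<bar>integral {0..t} (\<lambda>s. laplacian u (X s x))\<bar> \<le> C)
      \<longrightarrow> (\<exists>U. open U \<and> xs \<in> U \<and> (\<forall>y\<in>U. u y = u xs)))
   \<and>
    ((\<forall>x\<in>Q. X 0 x = x \<and>
         (\<forall>t\<le>0. ((\<lambda>s. X s x) has_vector_derivative grad u (X t x)) (at t within {..0})))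
      \<and> (\<forall>x\<in>Q. \<forall>t\<le>0. X t x \<in> K)
      \<and> (\<forall>x\<in>Q. \<forall>t\<le>0. \<bar>integral {t..0} (\<lambda>s. laplacian u (X s x))\<bar> \<le> C)
      \<longrightarrow> (\<exists>U. open U \<and> xs \<in> U \<and> (\<forall>y\<in>U. u y = u xs)))"
proof (intro conjI impI; elim conjE)
  assume X: "\<forall>x\<in>Q. X 0 x = x \<and>
         (\<forall>t\<ge>0. ((\<lambda>s. X s x) has_vector_derivative grad u (X t x)) (at t within {0..}))"
    and XK: "\<forall>x\<in>Q. \<forall>t\<ge>0. X t x \<in> K"
    and int: "\<forall>x\<in>Q. \<forall>t\<ge>0. \<bar>integral {0..t} (\<lambda>s. laplacian u (X s x))\<bar> \<le> C"
  \<comment> \<open>This violates the lower half of the assumed bound, so the conclusion follows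
    from a contradiction.\<close>
  have "\<exists>x\<in>Q. \<exists>t\<ge>0. integral {0..t} (\<lambda>s. laplacian u (X s x)) < - C"
    by (rule gradient_flow_integral_laplacian_unbounded[OF u_C2 K_compact _ Q_nbhd])
      (use K_isolated X XK in auto)
  with int show "\<exists>U. open U \<and> xs \<in> U \<and> (\<forall>y\<in>U. u y = u xs)"
    by force
next
  assume X: "\<forall>x\<in>Q. X 0 x = x \<and>
         (\<forall>t\<le>0. ((\<lambda>s. X s x) has_vector_derivative grad u (X t x)) (at t within {..0}))"
    and XK: "\<forall>x\<in>Q. \<forall>t\<le>0. X t x \<in> K"
    and int: "\<forall>x\<in>Q. \<forall>t\<le>0. \<bar>integral {t..0} (\<lambda>s. laplacian u (X s x))\<bar> \<le> C"
  \<comment> \<open>The reversed orbits \<open>X (- s) x\<close> follow the gradient of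
    \<open>- u\<close>, which has the same critical points. The Laplacian changes sign as well, so
    now the upper half of the bound is violated.\<close>
  have "\<exists>x\<in>Q. \<exists>t\<ge>0. integral {0..t} (\<lambda>s. laplacian (\<lambda>x. - u x) (X (- s) x)) < - C"
  proof (rule gradient_flow_integral_laplacian_unbounded[OF C2_minus[OF u_C2] K_compact _ Q_nbhd])
    fix x t assume x: "x \<in> Q" and t: "t \<ge> (0::real)"
    have "((\<lambda>s. X s x) has_vector_derivative grad u (X (- t) x)) (at (- t) within uminus ` {0..})"
      using X x t by (simp add: image_uminus_atLeast)
    moreover have "(uminus has_vector_derivative - 1) (at t within {0..})"
      by (auto intro!: derivative_eq_intros)
    ultimately have "((\<lambda>s. X s x) \<circ> uminus has_vector_derivative (- 1) *\<^sub>R grad u (X (- t) x)) (at t within {0..})"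
      by (intro vector_diff_chain_within)
    then show "((\<lambda>s. X (- s) x) has_vector_derivative grad (\<lambda>x. - u x) (X (- t) x)) (at t within {0..})"
      by (simp add: grad_minus[OF u_C2] o_def)
  qed (use K_isolated X XK in \<open>auto simp: grad_minus[OF u_C2]\<close>)
  then obtain x t where x: "x \<in> Q" "t \<ge> 0"
    "integral {0..t} (\<lambda>s. laplacian (\<lambda>x. - u x) (X (- s) x)) < - C"
    by blast
  have "integral {0..t} (\<lambda>s. laplacian (\<lambda>x. - u x) (X (- s) x)) = - integral {- t..0} (\<lambda>s. laplacian u (X s x))"
    using Henstock_Kurzweil_Integration.integral_reflect_real[where a = "- t" and b = 0 and f = "\<lambda>s. laplacian u (X s x)"] by (simp add: laplacian_minus[OF u_C2])
  with x(3) have "C < \<bar>integral {- t..0} (\<lambda>s. laplacian u (X s x))\<bar>"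
    by linarith
  moreover have "\<bar>integral {- t..0} (\<lambda>s. laplacian u (X s x))\<bar> \<le> C"
    using int x by auto
  ultimately show "\<exists>U. open U \<and> xs \<in> U \<and> (\<forall>y\<in>U. u y = u xs)"
    by linarith
qed

end
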